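(* Let $n\ge 1$ and let $T\in\mathbb{T}_n$ be an ordered tree. If $\mathit{NextTree}(T)$ returns null, then $T$ is the maximum element of $\mathbb{T}_n$; otherwise $\mathit{NextTree}(T)$ returns a tree of $\mathbb{T}_n$ that is immediately next to $T$ in $\mathbb{T}_n$.
   Context: Let $\mathbb{T}$ be the set of finite rooted trees in which every internal node has at least two children. For a node $v$, $T(v)$ is the subtree rooted at $v$ and $l(v)$ the number of leaves of $T(v)$; $\mathbb{T}_n=\{T\in\mathbb{T}:l(\mathrm{root}(T))=n\}$. For an integer $p\ge 2$, $\mathrm{Part}(p)$ is the set of non-decreasing sequences $(a_1,\dots,a_k)$ of positive integers with $k\ge 2$ and $\sum_i a_i=p$, ordered lexicographically: for distinct $a=(a_i)_k$, $b=(b_i)_m$, let $j$ be the least index $\le\min\{k,m\}$ with $a_j\ne b_j$; then $a<b$ iff $a_j<b_j$. Its maximum is $(\lfloor p/2\rfloor,\lceil p/2\rceil)$. Node comparison: define, by induction on the number of leaves, a comparison between nodes $v,w$ (of the same or different trees of $\mathbb{T}$) with outcomes $v<w$, $v\sim w$, or $w<v$: (1) if $l(v)<l(w)$ then $v<w$ (symmetrically); (2) if $l(v)=l(w)=1$ then $v\sim w$; (3) if $l(v)=l(w)\ge 2$, list the children of $v$ as $v_1,\dots,v_k$ and those of $w$ as $w_1,\dots,w_m$, each list non-decreasing with respect to this comparison (already defined for them); $(l(v_1),\dots,l(v_k))$ and $(l(w_1),\dots,l(w_m))\in\mathrm{Part}(l(v))$ are the partitions induced by $v$ and $w$. (3.1)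 If the partition induced by $v$ is lexicographically smaller (resp. larger) than that induced by $w$ then $v<w$ (resp. $w<v$). (3.2) If equal (so $k=m$): if $v_i\sim w_i$ for all $i$ then $v\sim w$; otherwise, with $j$ least such that $v_j\not\sim w_j$, $v<w$ if $v_j<w_j$ and $w<v$ otherwise. Write $v\le w$ if $v<w$ or $v\sim w$. For $T_1,T_2\in\mathbb{T}_n$, write $T_1<T_2$ (resp. $T_1\sim T_2$, $T_1\le T_2$) if $\mathrm{root}(T_1)<\mathrm{root}(T_2)$ (resp. $\sim$, $\le$). $T$ is the maximum element of $\mathbb{T}_n$ if $T'\le T$ for all $T'\in\mathbb{T}_n$; $T'\in\mathbb{T}_n$ is immediately next to $T$ if $T'>T$ and every $T''\in\mathbb{T}_n$ with $T''>T$ satisfies $T''\ge T'$. An ordered tree is a tree in $\mathbb{T}$ together with, for every internal node, an arrangement of its children as a sequence $v_1,\dots,v_k$ with $v_1\le\dots\le v_k$. For a node $x$ with parent $p$, the siblings of $x$ after $x$ are the children of $p$ arranged after $x$; the root has no siblings. A node $v$ is exhausted if it is a leaf or its induced partition is the maximum of $\mathrm{Part}(l(v))$. The inverted post-order traversal of an ordered tree traverses, for the root with children $v_1,\dots,v_k$ in their arrangement, the subtrees $T(v_k),\dots,T(v_1)$ recursively in inverted post-order and then visits the root. The pivot is the first visited node that is not exhausted, if any. Procedure $\mathit{NextTree}$, on input an ordered tree $T\in\mathbb{T}_n$: (i) find the pivot $v$; if none, return null. (ii) Let $b=(b_1,\dots,b_m)$ be the element of $\mathrm{Part}(l(v))$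 immediately next (in lexicographic order) to the partition induced by $v$. Replace $T(v)$ by the subtree in which $v$ has children $u_1,\dots,u_m$, arranged in this order, where $u_i$ is a leaf if $b_i=1$ and otherwise $u_i$ has exactly $b_i$ children, all leaves. (iii) Set $x:=v$ and repeat: for every sibling $y$ of $x$ after $x$, if $l(y)=l(x)$ replace $T(y)$ by a copy of the current $T(x)$, and otherwise replace $T(y)$ by the tree in which $y$ has exactly $l(y)$ children, all leaves; then set $x$ to be the parent of $x$; stop after the root has been processed. (iv) Return the resulting tree. *)

theory Defs
  imports Main "HOL-Library.Multiset"
begin

text \<open>
  A finite rooted tree is given by a rose tree. The order of the list of children is a
  presentation only: the comparison below re-sorts the children before using them. For
  an ordered tree, the list is the arrangement of the children. Nodes of a tree are
  addressed by paths of child indices from the root.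
\<close>

datatype tree = Node (children: "tree list")

abbreviation Leaf :: tree where
  "Leaf \<equiv> Node []"

fun leaves :: "tree \<Rightarrow> nat" where
  "leaves (Node ts) = (if ts = [] then 1 else sum_list (map leaves ts))"

fun proper :: "tree \<Rightarrow> bool" where
  "proper (Node ts) \<longleftrightarrow> (ts = [] \<or> length ts \<ge> 2) \<and> (\<forall>t\<in>set ts. proper t)"

definition trees :: "nat \<Rightarrow> tree set" where
  "trees n = {T. proper T \<and> leaves T = n}"


definition Part :: "nat \<Rightarrow> nat list set" where
  "Part p = {a. sorted a \<and> (\<forall>x\<in>set a. x > 0) \<and> length a \<ge> 2 \<and> sum_list a = p}"

definition part_less :: "nat list \<Rightarrow> nat list \<Rightarrow> bool" where
  "part_less a b \<longleftrightarrow>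
     (\<exists>j < min (length a) (length b). (\<forall>i<j. a ! i = b ! i) \<and> a ! j < b ! j)"

definition max_part :: "nat \<Rightarrow> nat list \<Rightarrow> bool" where
  "max_part p a \<longleftrightarrow> a \<in> Part p \<and> (\<forall>b\<in>Part p. b = a \<or> part_less b a)"

definition next_part :: "nat \<Rightarrow> nat list \<Rightarrow> nat list" where
  "next_part p a = (THE b. b \<in> Part p \<and> part_less a b \<and>
     (\<forall>c\<in>Part p. part_less a c \<longrightarrow> c = b \<or> part_less b c))"


fun insert_by :: "('a \<Rightarrow> 'a \<Rightarrow> bool) \<Rightarrow> 'a \<Rightarrow> 'a list \<Rightarrow> 'a list" where
  "insert_by le x [] = [x]"
| "insert_by le x (y # ys) = (if le x y then x # y # ys else y # insert_by le x ys)"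

fun sort_by :: "('a \<Rightarrow> 'a \<Rightarrow> bool) \<Rightarrow> 'a list \<Rightarrow> 'a list" where
  "sort_by le [] = []"
| "sort_by le (x # xs) = insert_by le x (sort_by le xs)"

lemma mset_insert_by [simp]: "mset (insert_by le x xs) = add_mset x (mset xs)"
  by (induction xs) auto

lemma mset_sort_by [simp]: "mset (sort_by le xs) = mset xs"
  by (induction xs) auto

lemma set_sort_by [simp]: "set (sort_by le xs) = set xs"
  by (metis mset_sort_by set_mset_mset)

lemma length_sort_by [simp]: "length (sort_by le xs) = length xs"
  by (metis mset_sort_by size_mset)

lemma insert_by_cong:
  "(\<And>y. y \<in> set xs \<Longrightarrow> le x y = le' x y) \<Longrightarrow> insert_by le x xs = insert_by le' x xs"
  by (induction xs) auto

lemma sort_by_cong [fundef_cong]: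
  assumes "xs = ys" and "\<And>x y. x \<in> set ys \<Longrightarrow> y \<in> set ys \<Longrightarrow> le x y = le' x y"
  shows "sort_by le xs = sort_by le' ys"
proof -
  have "sort_by le ys = sort_by le' ys"
    using assms(2)
  proof (induction ys)
    case (Cons y ys)
    then have "sort_by le ys = sort_by le' ys" by simp
    then show ?case using Cons.prems by (auto intro!: insert_by_cong)
  qed simp
  then show ?thesis using assms(1) by simp
qed


text \<open>\<open>Less\<close>, \<open>Sim\<close>, \<open>Greater\<close> stand for \<open>v < w\<close>, \<open>v \<sim> w\<close>, \<open>w < v\<close>.\<close>

datatype outcome = Less | Sim | Greater

text \<open>The outcome at the first position at which the entries are not similar.\<close>

fun first_diff :: "('a \<Rightarrow> 'a \<Rightarrow> outcome) \<Rightarrow> 'a list \<Rightarrow> 'a list \<Rightarrow> outcome" where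
  "first_diff c (x # xs) (y # ys) = (if c x y = Sim then first_diff c xs ys else c x y)"
| "first_diff c _ _ = Sim"

lemma first_diff_cong [fundef_cong]:
  assumes "xs = xs'" "ys = ys'"
    and "\<And>x y. x \<in> set xs' \<Longrightarrow> y \<in> set ys' \<Longrightarrow> c x y = c' x y"
  shows "first_diff c xs ys = first_diff c' xs' ys'"
  unfolding assms(1,2) using assms(3)
  by (induction c xs' ys' rule: first_diff.induct) auto

text \<open>
  The comparison of two nodes depends only on the subtrees rooted at them. The recursion is
  on the size so that it is total on all rose trees, including those with unary nodes.
\<close>

function compare_nodes :: "tree \<Rightarrow> tree \<Rightarrow> outcome" where
  "compare_nodes v w =
    (if leaves v < leaves w then Less
     else if leaves w < leaves v then Greater
     else if leaves v = 1 then Sim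
     else
       (let vs = sort_by (\<lambda>x y. compare_nodes x y \<noteq> Greater) (children v);
            ws = sort_by (\<lambda>x y. compare_nodes x y \<noteq> Greater) (children w);
            a = map leaves vs;
            b = map leaves ws
        in if a = b then first_diff compare_nodes vs ws
           else if part_less a b then Less
           else Greater))"
  by pat_completeness auto

lemma size_children: "x \<in> set (children v) \<Longrightarrow> size x < size v"
  by (cases v) (auto simp: less_Suc_eq_le dest: size_list_estimation'[OF _ order_refl])

termination
  by (relation "measure (\<lambda>(v, w). max (size v) (size w))")
     (auto dest!: size_children simp: less_max_iff_disj)

declare compare_nodes.simps [simp del]

definition node_less :: "tree \<Rightarrow> tree \<Rightarrow> bool" where
  "node_less v w \<longleftrightarrow> compare_nodes v w = Less"

definition node_le :: "tree \<Rightarrow> tree \<Rightarrow> bool" where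
  "node_le v w \<longleftrightarrow> compare_nodes v w = Less \<or> compare_nodes v w = Sim"

definition induced_part :: "tree \<Rightarrow> nat list" where
  "induced_part v = map leaves (sort_by node_le (children v))"

definition maximum_tree :: "nat \<Rightarrow> tree \<Rightarrow> bool" where
  "maximum_tree n T \<longleftrightarrow> T \<in> trees n \<and> (\<forall>T'\<in>trees n. node_le T' T)"

definition immediately_next :: "nat \<Rightarrow> tree \<Rightarrow> tree \<Rightarrow> bool" where
  "immediately_next n T T' \<longleftrightarrow> T' \<in> trees n \<and> node_less T T' \<and>
     (\<forall>T''\<in>trees n. node_less T T'' \<longrightarrow> node_le T' T'')"

fun ordered_tree :: "tree \<Rightarrow> bool" where
  "ordered_tree (Node ts) \<longleftrightarrow> sorted_wrt node_le ts \<and> (\<forall>t\<in>set ts. ordered_tree t)"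


fun subtree_at :: "tree \<Rightarrow> nat list \<Rightarrow> tree" where
  "subtree_at T [] = T"
| "subtree_at T (i # p) = subtree_at (children T ! i) p"

fun replace_at :: "tree \<Rightarrow> nat list \<Rightarrow> tree \<Rightarrow> tree" where
  "replace_at T [] S = S"
| "replace_at T (i # p) S = Node ((children T)[i := replace_at (children T ! i) p S])"

function inverted_post_order :: "tree \<Rightarrow> nat list list" where
  "inverted_post_order T =
     concat (map (\<lambda>i. map ((#) i) (inverted_post_order (children T ! i)))
       (rev [0..<length (children T)])) @ [[]]"
  by pat_completeness auto

termination
  by (relation "measure size") (auto intro: size_children)

declare inverted_post_order.simps [simp del]

definition exhausted :: "tree \<Rightarrow> bool" where
  "exhausted v \<longleftrightarrow> v = Leaf \<or> max_part (leaves v) (induced_part v)"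

definition pivot :: "tree \<Rightarrow> nat list option" where
  "pivot T = find (\<lambda>p. \<not> exhausted (subtree_at T p)) (inverted_post_order T)"

definition star :: "nat \<Rightarrow> tree" where
  "star k = Node (replicate k Leaf)"

definition leaf_or_star :: "nat \<Rightarrow> tree" where
  "leaf_or_star k = (if k = 1 then Leaf else star k)"

definition update_siblings :: "tree \<Rightarrow> nat list \<Rightarrow> tree" where
  "update_siblings T x =
    (if x = [] then T
     else
       (let ts = children (subtree_at T (butlast x));
            i = last x;
            update = (\<lambda>y. if leaves y = leaves (ts ! i) then ts ! i else star (leaves y))
        in replace_at T (butlast x)
             (Node (take (Suc i) ts @ map update (drop (Suc i) ts)))))"

function climb :: "tree \<Rightarrow> nat list \<Rightarrow> tree" where
  "climb T x =
    (let T' = update_siblings T x in if x = [] then T' else climb T' (butlast x))"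
  by pat_completeness auto

termination
  by (relation "measure (\<lambda>(T, x). length x)") auto

declare climb.simps [simp del]

definition next_tree :: "tree \<Rightarrow> tree option" where
  "next_tree T =
    (case pivot T of
       None \<Rightarrow> None
     | Some v \<Rightarrow>
         (let b = next_part (leaves (subtree_at T v)) (induced_part (subtree_at T v))
          in Some (climb (replace_at T v (Node (map leaf_or_star b))) v)))"

end

theory Submission
  imports Defs
begin

text \<open>
  The comparison is the lexicographic comparison of leaf number, induced partition and sorted
  list of children, hence a total preorder, whose least element among the trees with \<open>k \<ge> 2\<close>
  leaves is the star. A tree is maximal iff all its nodes are exhausted. If the last child that
  is not maximal is the \<open>i\<close>-th one, then a tree above \<open>T\<close> with the same partition exceeds \<open>T\<close> no
  later than at position \<open>i\<close>; so the least such tree keeps the children before \<open>i\<close>, replaces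
  the \<open>i\<close>-th one by its successor, and has the smallest possible children afterwards, which
  are copies of that successor as long as the leaf number does not grow, and stars from then on.
  If all children are maximal, the partition itself has to be increased.
\<close>

section \<open>Lexicographic comparison of partitions\<close>

lemma part_less_Nil [simp]: "\<not> part_less [] b" "\<not> part_less a []"
  by (auto simp: part_less_def)

lemma part_less_Cons [simp]:
  "part_less (x # a) (y # b) \<longleftrightarrow> x < y \<or> x = y \<and> part_less a b"
proof
  assume "part_less (x # a) (y # b)"
  then obtain j where j: "j < min (length (x # a)) (length (y # b))"
    "\<forall>i<j. (x # a) ! i = (y # b) ! i" "(x # a) ! j < (y # b) ! j"
    unfolding part_less_def by blast
  show "x < y \<or> x = y \<and> part_less a b"
  proof (cases j)
    case 0
    then show ?thesis using j by simp
  next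
    case (Suc k)
    have "x = y" using j(2) Suc by fastforce
    moreover have "\<forall>i<k. a ! i = b ! i" using j(2) Suc by fastforce
    ultimately show ?thesis using j Suc unfolding part_less_def by auto
  qed
next
  assume "x < y \<or> x = y \<and> part_less a b"
  then show "part_less (x # a) (y # b)"
  proof
    assume "x < y"
    then show ?thesis unfolding part_less_def by (intro exI[of _ 0]) simp
  next
    assume *: "x = y \<and> part_less a b"
    then obtain j where "j < min (length a) (length b)" "\<forall>i<j. a ! i = b ! i" "a ! j < b ! j"
      unfolding part_less_def by blast
    then show ?thesis using * unfolding part_less_def
      by (intro exI[of _ "Suc j"]) (auto simp: nth_Cons split: nat.split)
  qed
qed

lemma part_less_irrefl [simp]: "\<not> part_less a a"
  by (auto simp: part_less_def)

lemma part_less_trans: "part_less a b \<Longrightarrow> part_less b c \<Longrightarrow> part_less a c"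
proof (induction a arbitrary: b c)
  case (Cons x a)
  then show ?case by (cases b; cases c) auto
qed simp

lemma part_less_asym: "part_less a b \<Longrightarrow> \<not> part_less b a"
  using part_less_trans part_less_irrefl by blast

text \<open>Positive entries and equal sums exclude that one list is a proper prefix of the other,
  the case which \<open>part_less\<close> leaves undecided.\<close>

lemma part_less_total:
  assumes "sum_list a = sum_list b" "\<forall>x\<in>set a. 0 < x" "\<forall>x\<in>set b. 0 < x" "a \<noteq> b"
  shows "part_less a b \<or> part_less b a"
  using assms
proof (induction a arbitrary: b)
  case Nil
  then show ?case by (cases b) auto
next
  case (Cons x a)
  show ?case
  proof (cases b)
    case (Cons y b')
    then show ?thesis
      using Cons.IH[of b'] Cons.prems by (cases x y rule: linorder_cases) auto
  qed (use Cons.prems in auto)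
qed

text \<open>A first entry of \<open>c\<close> other than 1 decides at once; an entry 1 is stripped
  from both lists. This list of ones is the partition that a star induces.\<close>

lemma replicate_one_least:
  assumes "\<forall>x\<in>set c. 0 < x" "sum_list c = k"
  shows "c = replicate k 1 \<or> part_less (replicate k 1) c"
  using assms
proof (induction c arbitrary: k)
  case (Cons x c)
  then obtain m where m: "k = Suc m" by (cases k) auto
  show ?case using Cons m by (cases "x = 1") auto
qed simp

section \<open>Existence of the next partition\<close>

lemma length_le_sum_list: "\<forall>x\<in>set a. 0 < x \<Longrightarrow> length a \<le> sum_list (a :: nat list)"
  by (induction a) auto

lemma finite_Part: "finite (Part p)"
proof (rule finite_subset)
  show "Part p \<subseteq> {a. set a \<subseteq> {..p} \<and> length a \<le> p}"
    by (auto simp: Part_def length_le_sum_list member_le_sum_list)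
qed (simp add: finite_lists_length_le)

lemma Part_total: "a \<in> Part p \<Longrightarrow> b \<in> Part p \<Longrightarrow> a = b \<or> part_less a b \<or> part_less b a"
  using part_less_total[of a b] by (auto simp: Part_def)

lemma Part_least_exists:
  assumes "finite A" "A \<noteq> {}" "A \<subseteq> Part p"
  shows "\<exists>b\<in>A. \<forall>c\<in>A. c = b \<or> part_less b c"
  using assms
proof (induction A rule: finite_ne_induct)
  case (insert x A)
  then obtain b where b: "b \<in> A" "\<forall>c\<in>A. c = b \<or> part_less b c" by auto
  consider "x = b" | "part_less x b" | "part_less b x"
    using Part_total[of x p b] insert.prems b by auto
  then show ?case using b by cases (auto intro: part_less_trans)
qed simp

text \<open>Justifies the definite description in \<open>next_part\<close>: the larger partitions
  form a finite set, nonempty because \<open>a\<close> is not the maximum, and asymmetry makes its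
  least element unique.\<close>

lemma next_part:
  assumes "a \<in> Part p" "\<not> max_part p a"
  shows "next_part p a \<in> Part p \<and> part_less a (next_part p a) \<and>
     (\<forall>c\<in>Part p. part_less a c \<longrightarrow> c = next_part p a \<or> part_less (next_part p a) c)"
  unfolding next_part_def
proof (rule theI')
  let ?A = "{c \<in> Part p. part_less a c}"
  have "?A \<noteq> {}" using assms Part_total unfolding max_part_def by blast
  moreover have "finite ?A" using finite_Part by simp
  ultimately obtain b where b: "b \<in> ?A" "\<forall>c\<in>?A. c = b \<or> part_less b c"
    using Part_least_exists[of ?A p] by blast
  then show "\<exists>!b. b \<in> Part p \<and> part_less a b \<and>
     (\<forall>c\<in>Part p. part_less a c \<longrightarrow> c = b \<or> part_less b c)"
    by (intro ex1I[of _ b]) (auto dest: part_less_asym)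
qed

section \<open>The comparison is a total preorder\<close>

definition sorted_children :: "tree \<Rightarrow> tree list" where
  "sorted_children t = sort_by node_le (children t)"

lemma set_sorted_children [simp]: "set (sorted_children t) = set (children t)"
  by (simp add: sorted_children_def)

lemma length_sorted_children [simp]: "length (sorted_children t) = length (children t)"
  by (simp add: sorted_children_def)

lemma induced_part_eq: "induced_part t = map leaves (sorted_children t)"
  by (simp add: induced_part_def sorted_children_def)

lemma node_le_iff: "node_le v w \<longleftrightarrow> compare_nodes v w \<noteq> Greater"
  by (cases "compare_nodes v w") (auto simp: node_le_def)

text \<open>The predicate by which the recursion sorts the children is \<open>node_le\<close>
  itself, so the recursion can be restated through \<open>induced_part\<close> and
  \<open>sorted_children\<close>.\<close>

lemma compare_nodes_unfold:
  "compare_nodes v w =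
    (if leaves v < leaves w then Less
     else if leaves w < leaves v then Greater
     else if leaves v = 1 then Sim
     else if induced_part v = induced_part w
       then first_diff compare_nodes (sorted_children v) (sorted_children w)
     else if part_less (induced_part v) (induced_part w) then Less
     else Greater)"
proof -
  have "(\<lambda>x y. compare_nodes x y \<noteq> Greater) = node_le" by (simp add: node_le_iff fun_eq_iff)
  then show ?thesis
    by (subst compare_nodes.simps) (simp add: Let_def induced_part_eq sorted_children_def)
qed

lemma leaves_pos [simp]: "0 < leaves t"
proof (induction t)
  case (Node ts)
  then show ?case by (cases ts) auto
qed

lemma sum_list_induced_part: "children t \<noteq> [] \<Longrightarrow> sum_list (induced_part t) = leaves t"
proof -
  assume "children t \<noteq> []"
  moreover have "sum_list (induced_part t) = sum_list (map leaves (children t))"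
    by (metis induced_part_eq sorted_children_def mset_map mset_sort_by sum_mset_sum_list)
  ultimately show ?thesis by (cases t) simp
qed

lemma children_nonempty: "leaves t \<noteq> 1 \<Longrightarrow> children t \<noteq> []"
  by (cases t) auto

lemma induced_part_total:
  assumes "leaves v = leaves w" "leaves v \<noteq> 1" "induced_part v \<noteq> induced_part w"
  shows "part_less (induced_part v) (induced_part w) \<or> part_less (induced_part w) (induced_part v)"
proof (rule part_less_total)
  show "sum_list (induced_part v) = sum_list (induced_part w)"
    using assms by (simp add: sum_list_induced_part children_nonempty)
qed (use assms in \<open>auto simp: induced_part_eq\<close>)

section \<open>Antisymmetry and transitivity\<close>

fun opposite :: "outcome \<Rightarrow> outcome" where
  "opposite Less = Greater"
| "opposite Sim = Sim"
| "opposite Greater = Less"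

lemma opposite_eq [simp]:
  "opposite x = Less \<longleftrightarrow> x = Greater" "opposite x = Greater \<longleftrightarrow> x = Less"
  "opposite x = Sim \<longleftrightarrow> x = Sim"
  by (cases x; simp)+

text \<open>The hypothesis concerns only entries of \<open>xs\<close>, which is what an induction
  hypothesis on the children of one tree supplies.\<close>

lemma first_diff_opposite:
  assumes "\<And>x y. x \<in> set xs \<Longrightarrow> c y x = opposite (c x y)"
  shows "first_diff c ys xs = opposite (first_diff c xs ys)"
  using assms
proof (induction xs arbitrary: ys)
  case Nil
  then show ?case by (cases ys) auto
next
  case (Cons x xs)
  then show ?case by (cases ys) auto
qed

lemma compare_nodes_opposite: "compare_nodes w v = opposite (compare_nodes v w)"
proof (induction v arbitrary: w)
  case (Node ts)
  let ?v = "Node ts"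
  have fd: "first_diff compare_nodes (sorted_children w) (sorted_children ?v) =
      opposite (first_diff compare_nodes (sorted_children ?v) (sorted_children w))"
    by (rule first_diff_opposite) (use Node in simp)
  show ?case
    using fd induced_part_total[of ?v w] part_less_asym
    by (subst (1 2) compare_nodes_unfold) (auto simp del: leaves.simps)
qed

lemma compare_nodes_refl [simp]: "compare_nodes v v = Sim"
  using compare_nodes_opposite[of v v] by (cases "compare_nodes v v") auto

text \<open>Equal lengths matter: \<open>first_diff\<close> answers \<open>Sim\<close> as soon as a
  list ends, so transitivity can fail for lists of different lengths.\<close>

lemma first_diff_trans:
  assumes "length xs = length ys" "length ys = length zs"
    and "\<And>x y z. x \<in> set xs \<Longrightarrow> c x y \<noteq> Greater \<Longrightarrow> c y z \<noteq> Greater \<Longrightarrow>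
      c x z = (if c x y = Less \<or> c y z = Less then Less else Sim)"
    and "first_diff c xs ys \<noteq> Greater" "first_diff c ys zs \<noteq> Greater"
  shows "first_diff c xs zs =
    (if first_diff c xs ys = Less \<or> first_diff c ys zs = Less then Less else Sim)"
  using assms
proof (induction xs ys zs rule: list_induct3)
  case (Cons x xs y ys z zs)
  have xyz: "c x y \<noteq> Greater" "c y z \<noteq> Greater" using Cons.prems(2,3) by (auto split: if_splits)
  have "c x z = (if c x y = Less \<or> c y z = Less then Less else Sim)"
    using Cons.prems(1)[of x y z] xyz by simp
  moreover have "first_diff c xs zs =
    (if first_diff c xs ys = Less \<or> first_diff c ys zs = Less then Less else Sim)"
    if "c x y = Sim" "c y z = Sim"
    using Cons.IH Cons.prems that by simp
  ultimately show ?case using xyz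
    by (cases "c x y"; cases "c y z") auto
qed simp

text \<open>One equation covers the transitivity of \<le>, of similarity and of the mixed strict
  cases. The induction itself needs this strength, because the first difference of two chained lists
  of children depends on which link is strict.\<close>

lemma compare_nodes_trans:
  assumes "compare_nodes u v \<noteq> Greater" "compare_nodes v w \<noteq> Greater"
  shows "compare_nodes u w =
    (if compare_nodes u v = Less \<or> compare_nodes v w = Less then Less else Sim)"
  using assms
proof (induction u arbitrary: v w)
  case (Node ts)
  let ?u = "Node ts"
  consider "leaves ?u < leaves v" | "leaves v < leaves w" | "leaves ?u = leaves v" "leaves v = leaves w"
    using Node.prems compare_nodes_unfold[of ?u v] compare_nodes_unfold[of v w]
    by (metis linorder_neqE_nat outcome.distinct)
  then show ?case
  proof cases
    case 1
    then have "leaves ?u < leaves w"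
      using Node.prems(2) compare_nodes_unfold[of v w] by (auto split: if_splits)
    then show ?thesis using 1 compare_nodes_unfold[of ?u v] compare_nodes_unfold[of ?u w]
      by (simp del: leaves.simps)
  next
    case 2
    then have "leaves ?u < leaves w"
      using Node.prems(1) compare_nodes_unfold[of ?u v]
      by (auto split: if_splits simp del: leaves.simps)
    then show ?thesis using 2 compare_nodes_unfold[of v w] compare_nodes_unfold[of ?u w]
      by (simp del: leaves.simps)
  next
    case 3
    let ?a = "induced_part ?u" and ?b = "induced_part v" and ?c = "induced_part w"
    have fd: "first_diff compare_nodes (sorted_children ?u) (sorted_children w) =
        (if first_diff compare_nodes (sorted_children ?u) (sorted_children v) = Less \<or>
          first_diff compare_nodes (sorted_children v) (sorted_children w) = Less then Less else Sim)"
      if "?a = ?b" "?b = ?c"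
        "first_diff compare_nodes (sorted_children ?u) (sorted_children v) \<noteq> Greater"
        "first_diff compare_nodes (sorted_children v) (sorted_children w) \<noteq> Greater"
    proof (rule first_diff_trans)
      show "length (sorted_children ?u) = length (sorted_children v)"
        "length (sorted_children v) = length (sorted_children w)"
        using that(1,2) unfolding induced_part_eq by (metis length_map)+
    qed (use that Node.IH in simp_all)
    show ?thesis
    proof (cases "leaves v = 1")
      case True
      then show ?thesis using 3 by (simp add: compare_nodes_unfold del: leaves.simps)
    next
      case False
      have "?a = ?b \<or> part_less ?a ?b" "?b = ?c \<or> part_less ?b ?c"
        using Node.prems 3 False compare_nodes_unfold[of ?u v] compare_nodes_unfold[of v w]
        by (auto split: if_splits simp del: leaves.simps)
      then consider "?a = ?b" "?b = ?c" | "part_less ?a ?b" "?b = ?c" | "?a = ?b" "part_less ?b ?c"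
        | "part_less ?a ?b" "part_less ?b ?c" "part_less ?a ?c"
        using part_less_trans by blast
      then show ?thesis
      proof cases
        case 1
        then show ?thesis using fd Node.prems 3 False
            compare_nodes_unfold[of ?u v] compare_nodes_unfold[of v w] compare_nodes_unfold[of ?u w]
          by (simp del: leaves.simps)
      qed (use 3 False compare_nodes_unfold[of ?u v] compare_nodes_unfold[of v w]
             compare_nodes_unfold[of ?u w] in \<open>auto simp del: leaves.simps\<close>)
    qed
  qed
qed

section \<open>Order properties and sorted lists of children\<close>

lemma node_le_refl [simp]: "node_le v v"
  by (simp add: node_le_iff)

lemma node_le_trans: "node_le u v \<Longrightarrow> node_le v w \<Longrightarrow> node_le u w"
  using compare_nodes_trans[of u v w] by (simp add: node_le_iff)

lemma node_le_total: "node_le u v \<or> node_le v u"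
  using compare_nodes_opposite[of u v] by (simp add: node_le_iff)

lemma node_less_imp_le: "node_less u v \<Longrightarrow> node_le u v"
  by (simp add: node_less_def node_le_def)

lemma not_node_le: "\<not> node_le u v \<longleftrightarrow> node_less v u"
  using compare_nodes_opposite[of u v] by (simp add: node_le_iff node_less_def)

lemma node_le_imp_leaves_le: "node_le u v \<Longrightarrow> leaves u \<le> leaves v"
  using compare_nodes_unfold[of u v] by (auto simp: node_le_iff split: if_splits)

lemma node_le_if_leaves_less: "leaves u < leaves v \<Longrightarrow> node_le u v"
  by (simp add: node_le_iff compare_nodes_unfold)

lemma sorted_insert_by:
  assumes "sorted_wrt node_le xs"
  shows "sorted_wrt node_le (insert_by node_le x xs)"
proof -
  have set: "set (insert_by le x xs) = insert x (set xs)" for le :: "tree \<Rightarrow> tree \<Rightarrow> bool" and xs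
    by (induction xs) auto
  show ?thesis using assms
    by (induction xs) (use node_le_total in \<open>auto simp: set intro: node_le_trans\<close>)
qed

lemma sorted_sorted_children: "sorted_wrt node_le (sorted_children t)"
proof -
  have "sorted_wrt node_le (sort_by node_le xs)" for xs
    by (induction xs) (auto intro: sorted_insert_by)
  then show ?thesis by (simp add: sorted_children_def)
qed

text \<open>Insertion sort stops at the head of an already sorted list. For an ordered tree, the
  arrangement is therefore the list that the comparison sees.\<close>

lemma sorted_children_Node:
  assumes "sorted_wrt node_le ts"
  shows "sorted_children (Node ts) = ts"
proof -
  have "sort_by node_le ts = ts" using assms
  proof (induction ts)
    case (Cons t ts)
    then show ?case by (cases ts) auto
  qed simp
  then show ?thesis by (simp add: sorted_children_def)
qed

lemma sorted_induced_part: "sorted (induced_part t)"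
  unfolding induced_part_eq sorted_map
  by (rule sorted_wrt_mono_rel[OF _ sorted_sorted_children]) (rule node_le_imp_leaves_le)

lemma compare_nodes_same_leaves:
  assumes "leaves v = leaves w" "leaves v \<noteq> 1"
  shows "node_le v w \<longleftrightarrow> part_less (induced_part v) (induced_part w) \<or>
      induced_part v = induced_part w \<and>
      first_diff compare_nodes (sorted_children v) (sorted_children w) \<noteq> Greater"
    and "node_less v w \<longleftrightarrow> part_less (induced_part v) (induced_part w) \<or>
      induced_part v = induced_part w \<and>
      first_diff compare_nodes (sorted_children v) (sorted_children w) = Less"
  using assms by (auto simp: node_le_iff node_less_def compare_nodes_unfold)

text \<open>At the first position that is not similar, the pointwise inequality is strict. This is
  the usual way below to compare trees with equal partitions.\<close>

lemma first_diff_if_list_all2: "list_all2 node_le xs ys \<Longrightarrow> first_diff compare_nodes xs ys \<noteq> Greater"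
  by (induction rule: list_all2_induct) (auto simp: node_le_iff)

lemma first_diff_append:
  "length xs = length ys \<Longrightarrow> first_diff c (xs @ xs') (ys @ ys') =
    (if first_diff c xs ys = Sim then first_diff c xs' ys' else first_diff c xs ys)"
  by (induction xs ys rule: list_induct2) auto

lemma first_diff_refl: "first_diff compare_nodes xs xs = Sim"
  by (induction xs) auto

section \<open>Trees with a given number of leaves\<close>

lemma proper_leaves_ge_2:
  assumes "proper t" "t \<noteq> Leaf"
  shows "2 \<le> leaves t"
proof -
  obtain x y ts where "t = Node (x # y # ts)"
    using assms by (cases t) (auto simp: Suc_le_length_iff numeral_2_eq_2)
  then show ?thesis using leaves_pos[of x] leaves_pos[of y]
    by (simp del: leaves_pos)
qed

lemma induced_part_in_Part:
  assumes "proper t" "leaves t \<noteq> 1"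
  shows "induced_part t \<in> Part (leaves t)"
proof -
  have "2 \<le> length (induced_part t)"
    using assms by (cases t) (auto simp: induced_part_def)
  moreover have "\<forall>x\<in>set (induced_part t). 0 < x" by (auto simp: induced_part_eq)
  ultimately show ?thesis
    using assms sorted_induced_part sum_list_induced_part children_nonempty
    by (simp add: Part_def)
qed

section \<open>Stars as least trees\<close>

lemma leaves_star: "1 \<le> k \<Longrightarrow> leaves (star k) = k"
  by (simp add: star_def sum_list_replicate)

lemma proper_star: "2 \<le> k \<Longrightarrow> proper (star k)"
  by (simp add: star_def)

lemma leaves_leaf_or_star: "1 \<le> k \<Longrightarrow> leaves (leaf_or_star k) = k"
  by (simp add: leaf_or_star_def leaves_star)

lemma proper_leaf_or_star: "1 \<le> k \<Longrightarrow> proper (leaf_or_star k)"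
  by (simp add: leaf_or_star_def proper_star)

text \<open>The star induces the partition into ones, the least of all. A tree with the same
  partition has only children with one leaf, so the two lists of children are pointwise
  comparable.\<close>

lemma leaf_or_star_least:
  assumes "proper t"
  shows "node_le (leaf_or_star (leaves t)) t"
proof (cases "leaves t = 1")
  case True
  then show ?thesis by (simp add: leaf_or_star_def node_le_iff compare_nodes_unfold)
next
  case False
  let ?k = "leaves t"
  have k: "1 \<le> ?k" using leaves_pos[of t] by linarith
  have sc: "sorted_children (star ?k) = replicate ?k Leaf"
    unfolding star_def by (rule sorted_children_Node) (simp add: sorted_wrt_iff_nth_less)
  have ip: "induced_part (star ?k) = replicate ?k 1"
    by (simp add: induced_part_eq sc)
  have "induced_part t = replicate ?k 1 \<or> part_less (replicate ?k 1) (induced_part t)"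
    using induced_part_in_Part[OF assms False] by (intro replicate_one_least) (auto simp: Part_def)
  moreover have "list_all2 node_le (sorted_children (star ?k)) (sorted_children t)"
    if "induced_part t = replicate ?k 1"
  proof -
    have len: "length (sorted_children t) = ?k"
      using that unfolding induced_part_eq by (metis length_map length_replicate)
    moreover have "node_le Leaf (sorted_children t ! i)" if i: "i < ?k" for i
    proof -
      have "leaves (sorted_children t ! i) = 1"
        using \<open>induced_part t = replicate ?k 1\<close> i len unfolding induced_part_eq
        by (metis nth_map nth_replicate)
      then show ?thesis by (simp add: node_le_iff compare_nodes_unfold)
    qed
    ultimately show ?thesis by (simp add: sc list_all2_conv_all_nth)
  qed
  ultimately have "node_le (star ?k) t"
    using False k ip
    by (subst compare_nodes_same_leaves) (auto simp: leaves_star dest: first_diff_if_list_all2)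
  then show ?thesis using False by (simp add: leaf_or_star_def)
qed

section \<open>Maximal trees\<close>

lemma children_le_maximum:
  assumes "induced_part t = induced_part s" "proper t"
    and "\<And>x. x \<in> set (children s) \<Longrightarrow> maximum_tree (leaves x) x"
  shows "list_all2 node_le (sorted_children t) (sorted_children s)"
proof (rule list_all2_all_nthI)
  show len: "length (sorted_children t) = length (sorted_children s)"
    using assms(1) unfolding induced_part_eq by (metis length_map)
  fix i assume i: "i < length (sorted_children t)"
  let ?x = "sorted_children t ! i" and ?y = "sorted_children s ! i"
  \<comment> \<open>Equal partitions force equal leaf numbers at equal positions, so maximality of
    the child of \<open>s\<close> applies to its counterpart in \<open>t\<close>.\<close>
  have "leaves ?x = leaves ?y"
    using assms(1) i len unfolding induced_part_eq by (metis nth_map)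
  moreover have "?x \<in> set (children t)" "?y \<in> set (children s)"
    using i len by (metis nth_mem set_sorted_children)+
  moreover have "\<forall>x\<in>set (children t). proper x" using assms(2) by (cases t) auto
  ultimately show "node_le ?x ?y"
    using assms(3)[of ?y] by (auto simp: maximum_tree_def trees_def)
qed

text \<open>An exhausted internal root leaves no room for a larger partition; at equal partition,
  the maximality of the children decides.\<close>

lemma maximum_tree_if_exhausted:
  assumes "proper t" "exhausted t"
    and "\<And>x. x \<in> set (children t) \<Longrightarrow> maximum_tree (leaves x) x"
  shows "maximum_tree (leaves t) t"
  unfolding maximum_tree_def
proof (intro conjI ballI)
  show "t \<in> trees (leaves t)" using assms(1) by (simp add: trees_def)
  fix s assume s: "s \<in> trees (leaves t)"
  show "node_le s t"
  proof (cases "leaves t = 1")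
    case True
    then show ?thesis using s by (simp add: trees_def node_le_iff compare_nodes_unfold)
  next
    case False
    then have "max_part (leaves t) (induced_part t)"
      using assms(2) by (auto simp: exhausted_def)
    moreover have "induced_part s \<in> Part (leaves t)"
      using s False induced_part_in_Part[of s] by (simp add: trees_def)
    ultimately have "induced_part s = induced_part t \<or> part_less (induced_part s) (induced_part t)"
      by (auto simp: max_part_def)
    then show ?thesis
      using s False children_le_maximum[OF _ _ assms(3), of s]
      by (subst compare_nodes_same_leaves) (auto simp: trees_def dest: first_diff_if_list_all2)
  qed
qed

section \<open>Successors\<close>

text \<open>With all children maximal, no tree with the same partition lies above \<open>t\<close>,
  so the partition must grow. The least choice is the next partition, with the smallest tree for
  each of its entries.\<close>

lemma immediately_next_part:
  assumes "proper t" "\<not> exhausted t"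
    and max: "\<And>x. x \<in> set (children t) \<Longrightarrow> maximum_tree (leaves x) x"
  shows "immediately_next (leaves t) t
    (Node (map leaf_or_star (next_part (leaves t) (induced_part t))))"
proof -
  let ?a = "induced_part t"
  define b where "b = next_part (leaves t) ?a"
  define t' where "t' = Node (map leaf_or_star b)"
  have t1: "leaves t \<noteq> 1" using assms proper_leaves_ge_2[of t] by (auto simp: exhausted_def)
  have b: "b \<in> Part (leaves t)" "part_less ?a b"
    "\<And>c. c \<in> Part (leaves t) \<Longrightarrow> part_less ?a c \<Longrightarrow> c = b \<or> part_less b c"
    using next_part[of ?a "leaves t"] induced_part_in_Part[OF assms(1) t1] assms(2)
    by (auto simp: exhausted_def b_def)
  have pos: "\<And>k. k \<in> set b \<Longrightarrow> 1 \<le> k" using b(1) by (auto simp: Part_def Suc_le_eq)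
  have map_b: "map leaves (map leaf_or_star b) = b"
    using pos by (auto simp: leaves_leaf_or_star intro: map_idI)
  \<comment> \<open>Sortedness ensures that the comparison does not rearrange the new
    children.\<close>
  have srt: "sorted_wrt node_le (map leaf_or_star b)"
    unfolding sorted_wrt_map
  proof (rule sorted_wrt_mono_rel)
    show "sorted b" using b(1) by (simp add: Part_def)
    fix x y assume "x \<in> set b" "y \<in> set b" "x \<le> y"
    then show "node_le (leaf_or_star x) (leaf_or_star y)"
      using pos by (cases "x = y") (auto intro!: node_le_if_leaves_less simp: leaves_leaf_or_star)
  qed
  have sc: "sorted_children t' = map leaf_or_star b"
    unfolding t'_def using srt by (rule sorted_children_Node)
  have ip: "induced_part t' = b" unfolding induced_part_eq sc by (rule map_b)
  have lt': "leaves t' = leaves t"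
    using b(1) map_b by (auto simp: t'_def Part_def)
  have "proper t'"
    using b(1) pos by (auto simp: t'_def Part_def intro: proper_leaf_or_star)
  moreover have "node_less t t'"
    using lt' t1 ip b(2) by (simp add: compare_nodes_same_leaves)
  moreover have "node_le t' s" if s: "s \<in> trees (leaves t)" "node_less t s" for s
  proof -
    have ls: "leaves s = leaves t" "proper s" using s by (auto simp: trees_def)
    have "\<not> node_le s t" using s(2) not_node_le by blast
    \<comment> \<open>With equal partitions, the maximality of the children of \<open>t\<close>
      would give \<open>node_le s t\<close>.\<close>
    then have "?a \<noteq> induced_part s"
      using children_le_maximum[of s t, OF _ ls(2) max] ls t1
      by (auto simp: compare_nodes_same_leaves dest: first_diff_if_list_all2)
    then have "part_less ?a (induced_part s)"
      using s(2) ls t1 by (simp add: compare_nodes_same_leaves)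
    then have "induced_part s = b \<or> part_less b (induced_part s)"
      using b(3) induced_part_in_Part[of s] ls t1 by simp
    moreover have "list_all2 node_le (sorted_children t') (sorted_children s)"
      if eq: "induced_part s = b"
    proof -
      \<comment> \<open>The leaf numbers of the children of \<open>s\<close> are the entries of
        \<open>b\<close>, so each child is bounded below by the leaf or star of that size.\<close>
      have "list_all2 (\<lambda>x y. node_le (leaf_or_star (leaves x)) y)
          (sorted_children s) (sorted_children s)"
        using ls(2) by (cases s) (auto intro!: list.rel_refl_strong leaf_or_star_least)
      then have "list_all2 node_le (map leaf_or_star (map leaves (sorted_children s)))
          (sorted_children s)"
        by (simp add: list_all2_map1)
      then show ?thesis unfolding sc eq[unfolded induced_part_eq] .
    qed
    ultimately show ?thesis
      using lt' ls t1 ip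
      by (auto simp: compare_nodes_same_leaves dest: first_diff_if_list_all2)
  qed
  ultimately show ?thesis
    using lt' by (simp add: immediately_next_def trees_def t'_def b_def)
qed

section \<open>Replacing the siblings after a child\<close>

definition fill :: "tree \<Rightarrow> tree \<Rightarrow> tree" where
  "fill x y = (if leaves y = leaves x then x else star (leaves y))"

lemma leaves_fill [simp]: "leaves (fill x y) = leaves y"
  using leaves_pos[of y] by (simp add: fill_def leaves_star Suc_le_eq del: leaves_pos)

lemma proper_fill:
  assumes "proper x" "leaves x \<le> leaves y"
  shows "proper (fill x y)"
proof (cases "leaves x = leaves y")
  case False
  \<comment> \<open>\<open>star 1\<close> is a unary node and hence not proper; it does not arise
    here, since a sibling with more leaves than \<open>x\<close> has at least two.\<close>
  then have "2 \<le> leaves y" using assms(2) leaves_pos[of x] by linarith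
  then show ?thesis using False by (simp add: fill_def proper_star)
qed (use assms in \<open>simp add: fill_def\<close>)

lemma fill_mono: "leaves y \<le> leaves z \<Longrightarrow> node_le (fill x y) (fill x z)"
proof (cases "leaves y = leaves z")
  case True
  then show ?thesis by (simp add: fill_def)
qed (simp add: node_le_if_leaves_less)

lemma le_fill: "leaves x \<le> leaves y \<Longrightarrow> node_le x (fill x y)"
  using fill_mono[of x y x] by (simp add: fill_def)

text \<open>With equal leaf numbers \<open>fill x y\<close> is \<open>x\<close> itself, and
  otherwise it is a star, the least proper tree of its leaf number. So \<open>fill\<close> is the
  cheapest way to keep the list sorted after \<open>x\<close>.\<close>

lemma fill_le:
  assumes "proper z" "leaves y = leaves z" "leaves x \<le> leaves z" "node_le x z"
  shows "node_le (fill x y) z"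
proof (cases "leaves z = leaves x")
  case False
  then have "leaves z \<noteq> 1" using assms(3) leaves_pos[of x] by linarith
  then show ?thesis
    using False assms(2) leaf_or_star_least[OF assms(1)] by (simp add: fill_def leaf_or_star_def)
qed (use assms in \<open>simp add: fill_def\<close>)

text \<open>A larger tree with the same partition first exceeds the old one within \<open>A\<close>
  or at \<open>x\<close>, as the children in \<open>B\<close> cannot grow. In the first case it also
  exceeds the new tree. In the second its child there is at least \<open>x'\<close>, sortedness
  makes all later children at least \<open>x'\<close>, and \<open>fill\<close> is least under this
  bound.\<close>

lemma immediately_next_child:
  assumes "proper (Node (A @ x # B))" and srt: "sorted_wrt node_le (A @ x # B)"
    and next_x: "immediately_next (leaves x) x x'"
    and max: "\<And>y. y \<in> set B \<Longrightarrow> maximum_tree (leaves y) y"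
  shows "immediately_next (leaves (Node (A @ x # B))) (Node (A @ x # B))
    (Node (A @ x' # map (fill x') B))"
proof -
  define t where "t = Node (A @ x # B)"
  define t' where "t' = Node (A @ x' # map (fill x') B)"
  have x': "proper x'" "leaves x' = leaves x" "node_less x x'"
    "\<And>y. proper y \<Longrightarrow> leaves y = leaves x \<Longrightarrow> node_less x y \<Longrightarrow> node_le x' y"
    using next_x by (auto simp: immediately_next_def trees_def)
  have B: "leaves x' \<le> leaves y" if "y \<in> set B" for y
    using srt that x'(2) by (auto simp: sorted_wrt_append dest: node_le_imp_leaves_le)
  have sorted_B: "sorted_wrt node_le (map (fill x') B)"
    unfolding sorted_wrt_map
    by (rule sorted_wrt_mono_rel[of _ node_le])
       (use srt in \<open>auto simp: sorted_wrt_append intro: fill_mono dest: node_le_imp_leaves_le\<close>)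
  have x'_le: "node_le x' (fill x' y)" if "y \<in> set B" for y
    using that B by (simp add: le_fill)
  have A: "node_le y x'" if "y \<in> set A" for y
    using srt that x'(3) by (auto simp: sorted_wrt_append intro: node_le_trans node_less_imp_le)
  have srt': "sorted_wrt node_le (A @ x' # map (fill x') B)"
    using srt sorted_B x'_le A by (auto simp: sorted_wrt_append intro: node_le_trans)
  have sc: "sorted_children t = A @ x # B" "sorted_children t' = A @ x' # map (fill x') B"
    using srt srt' by (simp_all add: t_def t'_def sorted_children_Node)
  have lv: "map leaves (A @ x' # map (fill x') B) = map leaves (A @ x # B)"
    using x'(2) by simp
  have ip: "induced_part t' = induced_part t" unfolding induced_part_eq sc by (rule lv)
  have lt': "leaves t' = leaves t"
    using lv by (simp add: t_def t'_def del: map_append list.map)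
  have pt: "proper t" using assms(1) by (simp add: t_def)
  have t1: "leaves t \<noteq> 1" using proper_leaves_ge_2[OF pt] by (auto simp: t_def)
  have "proper t'"
    using pt x'(1) B by (auto simp: t_def t'_def intro: proper_fill)
  moreover have "node_less t t'"
    using lt' t1 ip x'(3)[unfolded node_less_def]
    by (simp add: compare_nodes_same_leaves sc first_diff_append first_diff_refl)
  moreover have "node_le t' s" if s: "s \<in> trees (leaves t)" "node_less t s" for s
  proof -
    have ls: "leaves s = leaves t" "proper s" using s by (auto simp: trees_def)
    show ?thesis
    proof (cases "part_less (induced_part t) (induced_part s)")
      case True
      then show ?thesis using ls lt' t1 ip by (simp add: compare_nodes_same_leaves)
    next
      case False
      then have eq: "induced_part s = induced_part t"
        and fd: "first_diff compare_nodes (A @ x # B) (sorted_children s) = Less"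
        using s(2) ls t1 sc by (auto simp: compare_nodes_same_leaves)
      \<comment> \<open>Equal partitions allow the children of \<open>s\<close> to be split at the
        position of \<open>x\<close>, with matching leaf numbers.\<close>
      have "map leaves (sorted_children s) = map leaves A @ leaves x # map leaves B"
        using eq by (simp add: induced_part_eq sc)
      then obtain A2 y C where ws: "sorted_children s = A2 @ y # C"
        and lvs: "map leaves A2 = map leaves A" "leaves y = leaves x" "map leaves C = map leaves B"
        by (auto simp: map_eq_append_conv map_eq_Cons_conv)
      have len: "length A = length A2" "length B = length C"
        using lvs by (metis length_map)+
      have proper_s: "proper z" if "z \<in> set (A2 @ y # C)" for z
      proof -
        have "z \<in> set (children s)" using that ws by (metis set_sorted_children)
        then show ?thesis using ls(2) by (cases s) auto
      qed
      have "first_diff compare_nodes (A @ x' # map (fill x') B) (A2 @ y # C) \<noteq> Greater"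
      proof (cases "first_diff compare_nodes A A2 = Sim")
        case False
        \<comment> \<open>A difference within \<open>A\<close> decides the comparisons of
          \<open>s\<close> with the old and with the new tree alike.\<close>
        then show ?thesis using fd len by (simp add: ws first_diff_append)
      next
        case True
        then have fd2: "first_diff compare_nodes (x # B) (y # C) = Less"
          using fd len by (simp add: ws first_diff_append)
        have nth_leaves: "leaves (C ! i) = leaves (B ! i)" if "i < length C" for i
          using lvs(3) that len by (metis nth_map)
        \<comment> \<open>The children in \<open>B\<close> are maximal, so the strict increase
          cannot come from positions after \<open>x\<close> and has to occur at \<open>x\<close>
          itself.\<close>
        have "list_all2 node_le C B"
        proof (rule list_all2_all_nthI)
          fix i assume i: "i < length C"
          have "maximum_tree (leaves (B ! i)) (B ! i)" using max len i by simp
          moreover have "proper (C ! i)" using proper_s i by simp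
          ultimately show "node_le (C ! i) (B ! i)"
            using nth_leaves[OF i] by (simp add: maximum_tree_def trees_def)
        qed (simp add: len)
        moreover have "first_diff compare_nodes C B = opposite (first_diff compare_nodes B C)"
          by (rule first_diff_opposite) (rule compare_nodes_opposite)
        ultimately have "first_diff compare_nodes B C \<noteq> Less"
          using first_diff_if_list_all2[of C B] by auto
        then have "node_less x y" using fd2 by (auto simp: node_less_def split: if_splits)
        then have x'y: "node_le x' y" using x'(4) proper_s lvs(2) by simp
        have "list_all2 node_le (map (fill x') B) C"
        proof (rule list_all2_all_nthI)
          fix i assume "i < length (map (fill x') B)"
          then have i: "i < length C" "i < length B" using len by simp_all
          \<comment> \<open>Sortedness of the children of \<open>s\<close> carries the lower bound
            \<open>x'\<close> from \<open>y\<close> to all later ones.\<close>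
          have "node_le y (C ! i)"
            using sorted_sorted_children[of s] i by (auto simp: ws sorted_wrt_append)
          then have "node_le x' (C ! i)" using x'y node_le_trans by blast
          then have "node_le (fill x' (B ! i)) (C ! i)"
            using fill_le[of "C ! i" "B ! i" x'] proper_s nth_leaves[of i] i
              node_le_imp_leaves_le[of x' "C ! i"] by simp
          then show "node_le (map (fill x') B ! i) (C ! i)" using i by simp
        qed (simp add: len)
        then show ?thesis
          using True len x'y by (auto simp: first_diff_append node_le_iff dest: first_diff_if_list_all2)
      qed
      then show ?thesis using eq ls lt' t1 ip ws sc by (simp add: compare_nodes_same_leaves)
    qed
  qed
  ultimately show ?thesis
    using lt' by (simp add: immediately_next_def trees_def t'_def t_def del: leaves.simps proper.simps)
qed

section \<open>The procedure\<close>

lemma find_append: "find P (xs @ ys) = (case find P xs of None \<Rightarrow> find P ys | Some x \<Rightarrow> Some x)"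
  by (induction xs) auto

text \<open>The concatenation runs through the indices downwards, so the first hit lies at the
  largest index whose list contains one. Abstracting the number of children to \<open>k\<close>
  permits an induction in which the new index is searched first.\<close>

lemma find_concat_rev_upt:
  defines "paths g k \<equiv> concat (map (\<lambda>i. map ((#) i) (g i)) (rev [0..<k]))"
  shows "find P (paths g k) = None \<Longrightarrow> i < k \<Longrightarrow> find (\<lambda>p. P (i # p)) (g i) = None"
    and "find P (paths g k) = Some q \<Longrightarrow> \<exists>i p. q = i # p \<and> i < k \<and>
      find (\<lambda>p. P (i # p)) (g i) = Some p \<and>
      (\<forall>j. i < j \<and> j < k \<longrightarrow> find (\<lambda>p. P (j # p)) (g j) = None)"
proof -
  show "find (\<lambda>p. P (i # p)) (g i) = None" if "find P (paths g k) = None" "i < k"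
    using that by (fastforce simp: find_None_iff paths_def)
  have map_find: "find P (map ((#) i) ps) = map_option ((#) i) (find (\<lambda>p. P (i # p)) ps)" for i ps
    by (induction ps) auto
  show "find P (paths g k) = Some q \<Longrightarrow> \<exists>i p. q = i # p \<and> i < k \<and>
      find (\<lambda>p. P (i # p)) (g i) = Some p \<and>
      (\<forall>j. i < j \<and> j < k \<longrightarrow> find (\<lambda>p. P (j # p)) (g j) = None)"
  proof (induction k)
    case (Suc k)
    show ?case
    proof (cases "find (\<lambda>p. P (k # p)) (g k)")
      case None
      then have "find P (paths g k) = Some q"
        using Suc.prems by (simp add: paths_def find_append map_find)
      then show ?thesis using Suc.IH None by (metis less_Suc_eq)
    next
      case (Some p)
      then have "q = k # p" using Suc.prems by (simp add: paths_def find_append map_find)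
      then show ?thesis using Some by auto
    qed
  qed (simp add: paths_def)
qed

text \<open>The three cases are those of \<open>maximum_tree_if_exhausted\<close>,
  \<open>immediately_next_part\<close> and \<open>immediately_next_child\<close>. The path
  \<open>p\<close> is relative to the child \<open>x\<close>, which suits a structural
  induction.\<close>

lemma pivot_cases:
  obtains (None) "pivot (Node ts) = None" "exhausted (Node ts)" "\<forall>t\<in>set ts. pivot t = None"
  | (Nil) "pivot (Node ts) = Some []" "\<not> exhausted (Node ts)" "\<forall>t\<in>set ts. pivot t = None"
  | (Cons) A x B p where "ts = A @ x # B" "pivot (Node ts) = Some (length A # p)" "pivot x = Some p"
      "\<forall>t\<in>set B. pivot t = None"
proof -
  let ?P = "\<lambda>p. \<not> exhausted (subtree_at (Node ts) p)"
  let ?g = "\<lambda>i. inverted_post_order (ts ! i)"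
  let ?ps = "concat (map (\<lambda>i. map ((#) i) (?g i)) (rev [0..<length ts]))"
  have piv: "pivot (Node ts) = (case find ?P ?ps of
      None \<Rightarrow> if exhausted (Node ts) then None else Some [] | Some q \<Rightarrow> Some q)"
    unfolding pivot_def
    by (subst inverted_post_order.simps) (simp add: find_append split: option.split)
  \<comment> \<open>A path \<open>i # p\<close> leads to the same subtree as \<open>p\<close> in
    child \<open>i\<close>, so the search in one block of the traversal is the search for the pivot
    of that child.\<close>
  have child: "find (\<lambda>p. ?P (i # p)) (?g i) = pivot (ts ! i)" for i
    by (simp add: pivot_def)
  show thesis
  proof (cases "find ?P ?ps")
    case N: None
    then have "\<forall>t\<in>set ts. pivot t = None"
      using find_concat_rev_upt(1)[of ?P ?g "length ts"] child by (metis in_set_conv_nth)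
    then show thesis using N piv None Nil by (cases "exhausted (Node ts)") auto
  next
    case S: (Some q)
    then obtain i p where q: "q = i # p" "i < length ts" "pivot (ts ! i) = Some p"
      "\<forall>j. i < j \<and> j < length ts \<longrightarrow> pivot (ts ! j) = None"
      using find_concat_rev_upt(2)[of ?P ?g "length ts" q] unfolding child by blast
    show thesis
    proof (rule Cons[of "take i ts" "ts ! i" "drop (Suc i) ts" p])
      show "ts = take i ts @ ts ! i # drop (Suc i) ts" using q(2) by (rule id_take_nth_drop)
      show "pivot (Node ts) = Some (length (take i ts) # p)" using piv S q by simp
      show "\<forall>t\<in>set (drop (Suc i) ts). pivot t = None"
        using q(4) by (auto simp: in_set_conv_nth)
    qed (rule q(3))
  qed
qed

section \<open>Climbing from the pivot to the root\<close>

lemma climb_Nil: "climb T [] = T"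
  by (subst climb.simps) (simp add: update_siblings_def)

lemma climb_snoc: "climb T (p @ [k]) = climb (update_siblings T (p @ [k])) p"
  by (subst climb.simps) (simp add: Let_def)

lemma update_siblings_Cons:
  "p \<noteq> [] \<Longrightarrow> update_siblings T (i # p) =
    Node ((children T)[i := update_siblings (children T ! i) p])"
  by (simp add: update_siblings_def Let_def)

text \<open>Turns the bottom-up loop into a recursion from the root: the updates along
  \<open>p\<close> stay inside child \<open>i\<close>, and only the last one, at \<open>[i]\<close>,
  touches its siblings. The induction removes the deep end of the path, where \<open>climb\<close>
  starts.\<close>

lemma climb_Cons:
  "i < length (children T) \<Longrightarrow> climb T (i # p) =
    update_siblings (Node ((children T)[i := climb (children T ! i) p])) [i]"
proof (induction p arbitrary: T rule: rev_induct)
  case Nil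
  then show ?case using climb_snoc[of T "[]" i] by (simp add: climb_Nil)
next
  case (snoc k p)
  then show ?case
    using climb_snoc[of T "i # p" k] by (simp add: climb_snoc update_siblings_Cons)
qed

text \<open>Identifies \<open>fill\<close> with the replacement that the procedure makes at one
  level.\<close>

lemma update_siblings_singleton:
  "update_siblings (Node (A @ x # B)) [length A] = Node (A @ x # map (fill x) B)"
  by (simp add: update_siblings_def fill_def)

text \<open>By \<open>climb_Cons\<close>, when the pivot lies inside \<open>x\<close> the procedure
  acts on \<open>x\<close> as it would on \<open>x\<close> alone, and one further round fills the
  siblings after it.\<close>

lemma next_tree_child:
  assumes "pivot (Node (A @ x # B)) = Some (length A # p)" "pivot x = Some p"
  obtains x' where "next_tree x = Some x'"
    "next_tree (Node (A @ x # B)) = Some (Node (A @ x' # map (fill x') B))"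
  using assms by (simp add: next_tree_def Let_def climb_Cons update_siblings_singleton)

lemma next_tree_None_iff: "next_tree T = None \<longleftrightarrow> pivot T = None"
  by (simp add: next_tree_def Let_def split: option.split)

text \<open>Structural induction along \<open>pivot_cases\<close>: children of an ordered tree are
  ordered, and a child without pivot is maximal by the induction hypothesis.\<close>

lemma next_tree_correct:
  assumes "proper T" "ordered_tree T"
  shows "(next_tree T = None \<longrightarrow> maximum_tree (leaves T) T) \<and>
    (\<forall>T'. next_tree T = Some T' \<longrightarrow> immediately_next (leaves T) T T')"
  using assms
proof (induction T)
  case (Node ts)
  have max: "maximum_tree (leaves t) t" if "t \<in> set ts" "pivot t = None" for t
    using Node.IH[of t] Node.prems that by (simp add: next_tree_None_iff)
  show ?case
  proof (cases ts rule: pivot_cases)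
    case None
    then show ?thesis
      using maximum_tree_if_exhausted[of "Node ts"] Node.prems max
      by (simp add: next_tree_None_iff[symmetric] del: leaves.simps proper.simps)
  next
    case Nil
    then have "immediately_next (leaves (Node ts)) (Node ts)
        (Node (map leaf_or_star (next_part (leaves (Node ts)) (induced_part (Node ts)))))"
      using immediately_next_part[of "Node ts"] Node.prems max
      by (simp del: leaves.simps proper.simps)
    then show ?thesis using Nil
      by (simp add: next_tree_def Let_def climb_Nil del: leaves.simps)
  next
    case (Cons A x B p)
    then obtain x' where x': "next_tree x = Some x'"
      "next_tree (Node ts) = Some (Node (A @ x' # map (fill x') B))"
      using next_tree_child by metis
    have "immediately_next (leaves x) x x'"
      using Node.IH[of x] Node.prems Cons(1) x'(1) by simp
    then have "immediately_next (leaves (Node ts)) (Node ts) (Node (A @ x' # map (fill x') B))"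
      unfolding Cons(1)
      by (rule immediately_next_child[rotated 2]) (use Node.prems Cons max in simp_all)
    then show ?thesis using x'(2) by (simp del: leaves.simps)
  qed
qed

theorem theorem2:
  fixes n :: nat and T :: tree
  assumes "n \<ge> 1" and "T \<in> trees n" and "ordered_tree T"
  shows "(next_tree T = None \<longrightarrow> maximum_tree n T) \<and>
    (\<forall>T'. next_tree T = Some T' \<longrightarrow> T' \<in> trees n \<and> immediately_next n T T')"
  using next_tree_correct[of T] assms by (auto simp: trees_def immediately_next_def)

end
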